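(* Let $\Sigma_1=(G_1,\sigma_1)$ and $\Sigma_2=(G_2,\sigma_2)$ be two finite, simple, connected signed graphs and let $\Sigma_1\times\Sigma_2$ be their tensor product. Then: (i) $\operatorname{bdim}(\Sigma_1\times\Sigma_2)\leq\operatorname{bdim}(\Sigma_1)$ if $\Sigma_2$ is balanced; (ii) $\operatorname{bdim}(\Sigma_1\times\Sigma_2)\leq\operatorname{bdim}(\Sigma_2)$ if $\Sigma_1$ is balanced.
   Context: A signed graph $\Sigma=(G,\sigma)$ is a graph $G=(V,E)$ with a function $\sigma:E\to\{+1,-1\}$. All graphs are finite, simple, connected and undirected unless otherwise mentioned (the tensor product itself may be disconnected). The sign of a cycle is the product of the signs of its edges; $\Sigma$ is balanced if it has no cycle of sign $-1$. Let $\Omega=\{-1,0,1\}$, with $\Omega^k\subset\mathbb{R}^k$ carrying the standard inner product $\langle\cdot,\cdot\rangle$. A vector valued switching function ($k$-switching function) for $\Sigma$ is a map $\zeta:V\to\Omega^k$ with $\langle\zeta(u),\zeta(v)\rangle\neq 0$ for every edge $uv\in E$; the switched signed graph $\Sigma^\zeta=(G,\sigma^\zeta)$ has $\sigma^\zeta(uv)=\sigma(uv)\operatorname{sgn}(\langle\zeta(u),\zeta(v)\rangle)$. The balancing dimension $\operatorname{bdim}(\Sigma)$ is the least integer $k\ge 1$ for which there is a $k$-switching function $\zeta:V\to\Omega^k$ such that $\Sigma^\zeta$ is all-positive (every edge has sign $+1$). The tensor product $\Sigma_1\times\Sigma_2$ is the signed graph on $G_1\times G_2$ (vertex set $V(G_1)\times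 V(G_2)$, with $(u_i,v_j)$ adjacent to $(u_k,v_l)$ iff $u_i\sim u_k$ and $v_j\sim v_l$) with signature $\sigma((u_i,v_j)(u_k,v_l))=\sigma_1(u_iu_k)\sigma_2(v_jv_l)$. *)

theory Defs
  imports Complex_Main "HOL-Library.FuncSet" "Graph_Theory.Graph_Theory"
begin

text \<open>
  The underlying graph is a symmetric loop-free digraph without parallel arcs (\<open>pair_graph\<close>): an
  edge \<open>uv\<close> is the pair of arcs \<open>(u, v)\<close> and \<open>(v, u)\<close>, so the signature is a symmetric function on
  arcs. Signs are real numbers so that they can be multiplied with the sign of an inner product.
  Values of the signature outside the arcs carry no meaning.
\<close>

record 'a signed_graph =
  ugraph :: "'a pair_pre_digraph"
  esign :: "'a \<times> 'a \<Rightarrow> real"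

locale signed_graph =
  fixes S :: "'a signed_graph"
  assumes pair_graph_ugraph: "pair_graph (ugraph S)"
    and esign_range: "e \<in> parcs (ugraph S) \<Longrightarrow> esign S e \<in> {1, -1}"
    and esign_sym: "(u, v) \<in> parcs (ugraph S) \<Longrightarrow> esign S (v, u) = esign S (u, v)"

definition cycle_sign :: "'a signed_graph \<Rightarrow> ('a \<times> 'a) list \<Rightarrow> real" where
  "cycle_sign S p = prod_list (map (esign S) p)"

text \<open>
  The library predicate \<open>cycle\<close> also accepts the closed walk \<open>u, v, u\<close> along a single edge, which is
  not a cycle of an undirected graph; the length condition excludes it.
\<close>

definition balanced :: "'a signed_graph \<Rightarrow> bool" where
  "balanced S \<longleftrightarrow>
     \<not> (\<exists>p. pre_digraph.cycle (with_proj (ugraph S)) p \<and> 3 \<le> length p \<and> cycle_sign S p = -1)"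

definition all_positive :: "'a signed_graph \<Rightarrow> bool" where
  "all_positive S \<longleftrightarrow> (\<forall>e \<in> parcs (ugraph S). esign S e = 1)"

text \<open>
  A vector of length \<open>k\<close> is a function on the coordinates \<open>{..<k}\<close>, because \<open>k\<close> is minimised over
  below.
\<close>

definition Omega :: "real set" where
  "Omega = {-1, 0, 1}"

definition Omega_vec :: "nat \<Rightarrow> (nat \<Rightarrow> real) set" where
  "Omega_vec k = {..<k} \<rightarrow>\<^sub>E Omega"

definition std_inner :: "nat \<Rightarrow> (nat \<Rightarrow> real) \<Rightarrow> (nat \<Rightarrow> real) \<Rightarrow> real" where
  "std_inner k x y = (\<Sum>i<k. x i * y i)"

definition switching_function :: "nat \<Rightarrow> 'a signed_graph \<Rightarrow> ('a \<Rightarrow> nat \<Rightarrow> real) \<Rightarrow> bool" where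
  "switching_function k S \<zeta> \<longleftrightarrow>
     \<zeta> \<in> pverts (ugraph S) \<rightarrow> Omega_vec k \<and>
     (\<forall>(u, v) \<in> parcs (ugraph S). std_inner k (\<zeta> u) (\<zeta> v) \<noteq> 0)"

definition switched :: "nat \<Rightarrow> 'a signed_graph \<Rightarrow> ('a \<Rightarrow> nat \<Rightarrow> real) \<Rightarrow> 'a signed_graph" where
  "switched k S \<zeta> =
     \<lparr> ugraph = ugraph S,
       esign = (\<lambda>(u, v). esign S (u, v) * sgn (std_inner k (\<zeta> u) (\<zeta> v))) \<rparr>"

definition bdim :: "'a signed_graph \<Rightarrow> nat" where
  "bdim S = (LEAST k. 1 \<le> k \<and> (\<exists>\<zeta>. switching_function k S \<zeta> \<and> all_positive (switched k S \<zeta>)))"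

definition tensor_product :: "'a signed_graph \<Rightarrow> 'b signed_graph \<Rightarrow> ('a \<times> 'b) signed_graph" where
  "tensor_product S T =
     \<lparr> ugraph =
         \<lparr> pverts = pverts (ugraph S) \<times> pverts (ugraph T),
           parcs = {((u, v), (x, y)) | u v x y.
                      (u, x) \<in> parcs (ugraph S) \<and> (v, y) \<in> parcs (ugraph T)} \<rparr>,
       esign = (\<lambda>((u, v), (x, y)). esign S (u, x) * esign T (v, y)) \<rparr>"

lemma pair_graph_symD: "pair_graph G \<Longrightarrow> (u, v) \<in> parcs G \<Longrightarrow> (v, u) \<in> parcs G"
  unfolding pair_graph_def pair_pseudo_graph_def pair_sym_digraph_def pair_sym_digraph_axioms_def
    symmetric_def
  by (auto dest: symD)

lemma signed_graph_tensor_product: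
  assumes "signed_graph S" and "signed_graph T"
  shows "signed_graph (tensor_product S T)"
proof -
  interpret S: signed_graph S by fact
  interpret T: signed_graph T by fact
  interpret GS: pair_graph "ugraph S" by (rule S.pair_graph_ugraph)
  interpret GT: pair_graph "ugraph T" by (rule T.pair_graph_ugraph)
  let ?P = "ugraph (tensor_product S T)"
  have arcs: "parcs ?P \<subseteq> pverts ?P \<times> pverts ?P"
    by (auto simp: tensor_product_def dest: GS.in_arcsD1 GS.in_arcsD2 GT.in_arcsD1 GT.in_arcsD2)
  have fin: "finite (pverts ?P)"
    by (simp add: tensor_product_def GS.pair_finite_verts GT.pair_finite_verts)
  have "pair_graph ?P"
  proof unfold_locales
    show "finite (pverts ?P)" by (rule fin)
    show "finite (parcs ?P)" using arcs fin by (meson finite_SigmaI finite_subset)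
    show "symmetric (with_proj ?P)"
      by (auto simp: symmetric_def tensor_product_def intro!: symI
          intro: pair_graph_symD[OF S.pair_graph_ugraph] pair_graph_symD[OF T.pair_graph_ugraph])
    show "fst e \<in> pverts ?P" if "e \<in> parcs ?P" for e using that arcs by auto
    show "snd e \<in> pverts ?P" if "e \<in> parcs ?P" for e using that arcs by auto
    show "fst e \<noteq> snd e" if "e \<in> parcs ?P" for e
      using that by (auto simp: tensor_product_def dest: GS.pair_no_loops)
  qed
  moreover have "esign (tensor_product S T) e \<in> {1, -1}" if "e \<in> parcs ?P" for e
    using that by (auto simp: tensor_product_def dest!: S.esign_range T.esign_range)
  moreover have "esign (tensor_product S T) (b, a) = esign (tensor_product S T) (a, b)"
    if "(a, b) \<in> parcs ?P" for a b
    using that by (auto simp: tensor_product_def S.esign_sym T.esign_sym)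
  ultimately show ?thesis by (simp add: signed_graph_def)
qed

text \<open>
  The minimum in \<open>bdim\<close> is over a nonempty set: the signed incidence vectors of the vertices, with
  one coordinate for each arc, switch every signed graph to an all-positive one.
\<close>

lemma switching_function_exists:
  assumes "signed_graph S"
  shows "\<exists>k\<ge>1. \<exists>\<zeta>. switching_function k S \<zeta> \<and> all_positive (switched k S \<zeta>)"
proof -
  interpret S: signed_graph S by fact
  interpret G: pair_graph "ugraph S" by (rule S.pair_graph_ugraph)
  define A where "A = parcs (ugraph S)"
  define N where "N = card A"
  have finA: "finite A" by (simp add: A_def G.pair_finite_arcs)
  obtain f where f: "bij_betw f {..<N} A"
    using ex_bij_betw_nat_finite[OF finA] by (auto simp: N_def atLeast0LessThan)
  define h where "h u e = (if u = fst e then 1 else if u = snd e then esign S e else 0)" for u e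
  define z where "z u = (\<lambda>i\<in>{..<Suc N}. if i < N then h u (f i) else 0)" for u
  have h_Omega: "h u e \<in> Omega" if "e \<in> A" for u e
    using S.esign_range[of e] that by (auto simp: h_def Omega_def A_def)
  have z_vec: "z u \<in> Omega_vec (Suc N)" for u
    using h_Omega bij_betwE[OF f] by (auto simp: z_def Omega_vec_def Omega_def)
  have inner: "std_inner (Suc N) (z u) (z v) = 2 * esign S (u, v)" if uv: "(u, v) \<in> A" for u v
  proof -
    have vu: "(v, u) \<in> A"
      using uv pair_graph_symD[OF S.pair_graph_ugraph] by (simp add: A_def)
    have ne: "u \<noteq> v" using uv G.pair_no_loops[of "(u, v)"] by (simp add: A_def)
    have sym: "esign S (v, u) = esign S (u, v)" using uv S.esign_sym by (simp add: A_def)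
    have "std_inner (Suc N) (z u) (z v) = (\<Sum>i<N. h u (f i) * h v (f i))"
      by (simp add: std_inner_def z_def)
    also have "\<dots> = (\<Sum>e\<in>A. h u e * h v e)"
      by (rule sum.reindex_bij_betw[OF f])
    also have "\<dots> = (\<Sum>e\<in>{(u, v), (v, u)}. h u e * h v e)"
      using uv vu ne finA by (intro sum.mono_neutral_right) (auto simp: h_def)
    also have "\<dots> = 2 * esign S (u, v)"
      using ne sym by (simp add: h_def)
    finally show ?thesis .
  qed
  have sgn_pm: "esign S e = 1 \<or> esign S e = -1" if "e \<in> A" for e
    using S.esign_range that by (auto simp: A_def)
  have "switching_function (Suc N) S z"
    using z_vec inner sgn_pm unfolding switching_function_def A_def[symmetric] by fastforce
  moreover have "esign S e * sgn (2 * esign S e) = 1" if "e \<in> A" for e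
    using sgn_pm[OF that] by auto
  then have "all_positive (switched (Suc N) S z)"
    using inner by (auto simp: all_positive_def switched_def A_def)
  ultimately show ?thesis by (intro exI[of _ "Suc N"]) auto
qed

end

theory Submission
  imports Defs
begin

text \<open>
  In a balanced connected signed graph every closed walk is positive, because a closed walk that is
  not a cycle splits into shorter closed walks or retraces a single edge. Hence the sign \<open>\<theta> v\<close> of a
  walk from a fixed root to \<open>v\<close> depends only on \<open>v\<close>, and the sign of an edge \<open>uv\<close> is \<open>\<theta> u * \<theta> v\<close>.
  If \<open>\<Sigma>\<^sub>2\<close> is balanced and \<open>\<zeta>\<close> switches \<open>\<Sigma>\<^sub>1\<close> to all-positive, then
  \<open>(u, v) \<mapsto> \<theta> v \<cdot> \<zeta> u\<close> switches \<open>\<Sigma>\<^sub>1 \<times> \<Sigma>\<^sub>2\<close> to all-positive in the same dimension.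
\<close>

lemma cycle_sign_append: "cycle_sign S (p @ q) = cycle_sign S p * cycle_sign S q"
  by (simp add: cycle_sign_def)

lemma cycle_sign_Cons: "cycle_sign S (e # p) = esign S e * cycle_sign S p"
  by (simp add: cycle_sign_def)

lemma cycle_sign_Nil: "cycle_sign S [] = 1"
  by (simp add: cycle_sign_def)

lemmas cycle_sign_simps = cycle_sign_append cycle_sign_Cons cycle_sign_Nil

context signed_graph
begin

sublocale pair_graph "ugraph S"
  by (rule pair_graph_ugraph)

lemma cycle_sign_cases:
  assumes "set p \<subseteq> parcs (ugraph S)"
  shows "cycle_sign S p = 1 \<or> cycle_sign S p = -1"
  using assms
proof (induction p)
  case Nil
  show ?case by (simp add: cycle_sign_simps)
next
  case (Cons e p)
  then show ?case using esign_range[of e] by (auto simp: cycle_sign_simps)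
qed

text \<open>\<open>balanced\<close> constrains only cycles of length at least 3, so the shorter ones
  that \<open>cycle\<close> admits need their own argument: length 1 would be a loop, and length 2
  traverses one edge both ways, giving a squared sign.\<close>

lemma balanced_cycle_sign:
  assumes "balanced S" and "cycle p"
  shows "cycle_sign S p = 1"
proof -
  obtain u where walk: "awalk u p u" and "p \<noteq> []"
    using \<open>cycle p\<close> unfolding cycle_def by blast
  \<comment> \<open>\<open>remdups_adj.cases\<close> serves only as a case split into empty,
    singleton and longer lists.\<close>
  then consider e where "p = [e]" | e f where "p = [e, f]" | "3 \<le> length p"
    by (cases p rule: remdups_adj.cases) (auto simp: Suc_le_eq)
  then show ?thesis
  proof cases
    case (1 e)
    then have "e \<in> parcs (ugraph S)" "fst e = snd e"
      using walk by (auto simp: awalk_Cons_iff awalk_Nil_iff)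
    then show ?thesis using pair_no_loops by blast
  next
    case (2 e f)
    then have e: "e \<in> parcs (ugraph S)" and f: "f = (snd e, fst e)"
      using walk by (auto simp: awalk_Cons_iff awalk_Nil_iff prod_eq_iff)
    have "esign S f = esign S e"
      using e f esign_sym[of "fst e" "snd e"] by simp
    then show ?thesis using esign_range[OF e] 2 by (auto simp: cycle_sign_simps)
  next
    case 3
    then have "cycle_sign S p \<noteq> -1" using assms by (auto simp: balanced_def)
    then show ?thesis using cycle_sign_cases[of p] walk by (auto simp: awalk_def)
  qed
qed

lemma balanced_closed_walk_sign:
  assumes "balanced S" and "awalk u p u"
  shows "cycle_sign S p = 1"
  using assms(2)
\<comment> \<open>The base point varies because the closed walk cut out below starts at another
  vertex.\<close>
proof (induction p arbitrary: u rule: length_induct)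
  case (1 p)
  show ?case
  proof (cases p)
    case Nil
    then show ?thesis by (simp add: cycle_sign_simps)
  next
    case (Cons e p')
    then have e: "e \<in> parcs (ugraph S)" "u = fst e" and p': "awalk (snd e) p' u"
      using "1.prems" by (auto simp: awalk_Cons_iff)
    show ?thesis
    \<comment> \<open>\<open>cycle\<close> asks for distinct vertices after the first one, and these
      are the vertices of \<open>p'\<close>.\<close>
    proof (cases "distinct (awalk_verts (snd e) p')")
      case True
      then have "cycle p" using "1.prems" Cons unfolding cycle_def
        by (intro exI[of _ u]) (simp del: awalk_verts_with_proj_eq)
      then show ?thesis using balanced_cycle_sign \<open>balanced S\<close> by blast
    next
      case False
      \<comment> \<open>A repeated vertex \<open>w\<close> cuts out a closed walk \<open>r\<close>.
        It is shorter than \<open>p\<close> because it omits \<open>e\<close>; the remainder is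
        shorter because \<open>r\<close> is nonempty.\<close>
      then obtain q r s w where p'_eq: "p' = q @ r @ s" and "r \<noteq> []"
        and w: "awalk (snd e) q w" "awalk w r w" "awalk w s u"
        using awalk_not_distinct_decomp[OF p'] by auto
      have "awalk u (e # q @ s) u"
        using e awalk_appendI[OF w(1,3)] by (simp add: awalk_Cons_iff)
      moreover have "length (e # q @ s) < length p" "length r < length p"
        using \<open>r \<noteq> []\<close> by (auto simp: Cons p'_eq)
      ultimately have "cycle_sign S (e # q @ s) = 1" "cycle_sign S r = 1"
        using "1.IH" w(2) by blast+
      then show ?thesis by (simp add: Cons p'_eq cycle_sign_simps)
    qed
  qed
qed

lemma balanced_potential:
  assumes "balanced S" and "Digraph_Component.connected (with_proj (ugraph S))"
  obtains \<theta> where "\<And>v. v \<in> pverts (ugraph S) \<Longrightarrow> \<theta> v \<in> {1, -1 :: real}"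
    and "\<And>u v. (u, v) \<in> parcs (ugraph S) \<Longrightarrow> esign S (u, v) = \<theta> u * \<theta> v"
proof -
  \<comment> \<open>Symmetry of the arcs turns connectedness into directed walks between any two
    vertices.\<close>
  have strong: "strongly_connected (with_proj (ugraph S))"
    using symmetric_connected_imp_strongly_connected pair_sym_arcs assms(2) by blast
  then obtain r where r: "r \<in> pverts (ugraph S)"
    by (auto simp: strongly_connected_def)
  have walk_ex: "\<exists>p. awalk u p v" if "u \<in> pverts (ugraph S)" "v \<in> pverts (ugraph S)" for u v
    using strong that by (simp add: strongly_connected_def reachable_awalk)
  define P where "P v = (SOME p. awalk r p v)" for v
  have P: "awalk r (P v) v" if "v \<in> pverts (ugraph S)" for v
    unfolding P_def using walk_ex[OF r that] by (rule someI_ex)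
  define \<theta> where "\<theta> v = cycle_sign S (P v)" for v
  have \<theta>: "\<theta> v = 1 \<or> \<theta> v = -1" if "v \<in> pverts (ugraph S)" for v
    using P[OF that] cycle_sign_cases by (simp add: \<theta>_def awalk_def)
  have "esign S (u, v) = \<theta> u * \<theta> v" if uv: "(u, v) \<in> parcs (ugraph S)" for u v
  proof -
    have u: "u \<in> pverts (ugraph S)" and v: "v \<in> pverts (ugraph S)"
      using uv by (auto dest: in_arcsD1 in_arcsD2)
    \<comment> \<open>The same return walk \<open>b\<close> closes both the walk to \<open>u\<close>
      extended by the arc to \<open>v\<close> and the chosen walk to \<open>v\<close>. Both closed
      walks are positive, so the sign of \<open>b\<close> cancels.\<close>
    obtain b where b: "awalk v b r" using walk_ex v r by blast
    have "awalk u ((u, v) # b) r" using uv b by (simp add: awalk_Cons_iff)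
    then have "\<theta> u * (esign S (u, v) * cycle_sign S b) = 1" "\<theta> v * cycle_sign S b = 1"
      using balanced_closed_walk_sign[OF assms(1) awalk_appendI] P[OF u] P[OF v] b
      by (metis \<theta>_def cycle_sign_append cycle_sign_Cons)+
    then show ?thesis using \<theta>[OF u] \<theta>[OF v] by auto
  qed
  with \<theta> show thesis by (intro that[of \<theta>]) auto
qed

end

text \<open>
  The map \<open>f\<close> is a homomorphism of the underlying graphs that preserves signs up to the ordinary
  switching \<open>\<theta>\<close>; it is a coordinate projection below.
\<close>

lemma bdim_le_of_hom:
  fixes S :: "'a signed_graph" and T :: "'b signed_graph"
  assumes "signed_graph S"
    and verts: "\<And>x. x \<in> pverts (ugraph T) \<Longrightarrow> f x \<in> pverts (ugraph S) \<and> \<theta> x \<in> {1, -1 :: real}"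
    and arcs: "\<And>x y. (x, y) \<in> parcs (ugraph T) \<Longrightarrow>
      (f x, f y) \<in> parcs (ugraph S) \<and> x \<in> pverts (ugraph T) \<and> y \<in> pverts (ugraph T) \<and>
      esign T (x, y) = \<theta> x * \<theta> y * esign S (f x, f y)"
  shows "bdim T \<le> bdim S"
proof -
  define k where "k = bdim S"
  \<comment> \<open>The minimum is attained because every signed graph has some all-positive
    switching.\<close>
  have "1 \<le> k \<and> (\<exists>\<zeta>. switching_function k S \<zeta> \<and> all_positive (switched k S \<zeta>))"
    unfolding k_def bdim_def
    by (rule LeastI_ex) (use switching_function_exists[OF \<open>signed_graph S\<close>] in blast)
  then obtain \<zeta> where "1 \<le> k" and sw: "switching_function k S \<zeta>"
    and pos: "all_positive (switched k S \<zeta>)"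
    by blast
  \<comment> \<open>Pull \<zeta> back along \<open>f\<close> and scale by \<theta>. The restriction
    to \<open>{..<k}\<close> is needed because \<open>Omega_vec\<close> consists of extensional
    functions.\<close>
  define \<xi> where "\<xi> x = (\<lambda>i\<in>{..<k}. \<theta> x * \<zeta> (f x) i)" for x
  have inner: "std_inner k (\<xi> x) (\<xi> y) = \<theta> x * \<theta> y * std_inner k (\<zeta> (f x)) (\<zeta> (f y))" for x y
    by (simp add: std_inner_def \<xi>_def sum_distrib_left algebra_simps)
  have vec: "\<xi> x \<in> Omega_vec k" if "x \<in> pverts (ugraph T)" for x
  proof -
    have "\<zeta> (f x) \<in> Omega_vec k" using sw verts[OF that] by (auto simp: switching_function_def)
    then have "\<zeta> (f x) i \<in> Omega" if "i < k" for i
      using that by (auto simp: Omega_vec_def)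
    then have "\<theta> x * \<zeta> (f x) i \<in> Omega" if "i < k" for i
      using verts[OF \<open>x \<in> _\<close>] that by (fastforce simp: Omega_def)
    then show ?thesis by (auto simp: Omega_vec_def \<xi>_def)
  qed
  have "std_inner k (\<xi> x) (\<xi> y) \<noteq> 0 \<and> esign T (x, y) * sgn (std_inner k (\<xi> x) (\<xi> y)) = 1"
    if "(x, y) \<in> parcs (ugraph T)" for x y
  proof -
    note a = arcs[OF that]
    have \<theta>: "\<theta> x \<in> {1, -1}" "\<theta> y \<in> {1, -1}" using a verts by blast+
    have "std_inner k (\<zeta> (f x)) (\<zeta> (f y)) \<noteq> 0"
      using sw a by (auto simp: switching_function_def)
    moreover have "esign S (f x, f y) * sgn (std_inner k (\<zeta> (f x)) (\<zeta> (f y))) = 1"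
      using pos a by (auto simp: all_positive_def switched_def)
    \<comment> \<open>The factor \<open>\<theta> x * \<theta> y\<close> occurs once in the sign of
      the arc and once in the inner product, and its square is 1.\<close>
    ultimately show ?thesis using a \<theta> by (auto simp: inner sgn_mult)
  qed
  with vec have "switching_function k T \<xi> \<and> all_positive (switched k T \<xi>)"
    by (auto simp: switching_function_def all_positive_def switched_def)
  with \<open>1 \<le> k\<close> show ?thesis
    unfolding k_def[symmetric] bdim_def[of T] by (intro Least_le) blast
qed

theorem theorem2p28:
  fixes S1 :: "'a signed_graph" and S2 :: "'b signed_graph"
  assumes "signed_graph S1" and "Digraph_Component.connected (with_proj (ugraph S1))"
    and "signed_graph S2" and "Digraph_Component.connected (with_proj (ugraph S2))"
  shows "(balanced S2 \<longrightarrow> bdim (tensor_product S1 S2) \<le> bdim S1) \<and>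
         (balanced S1 \<longrightarrow> bdim (tensor_product S1 S2) \<le> bdim S2)"
proof (intro conjI impI)
  interpret S1: signed_graph S1 by fact
  interpret S2: signed_graph S2 by fact
  note arc_ends = S1.in_arcsD1 S1.in_arcsD2 S2.in_arcsD1 S2.in_arcsD2
  show "bdim (tensor_product S1 S2) \<le> bdim S1" if "balanced S2"
  proof -
    obtain \<theta> where \<theta>: "\<And>v. v \<in> pverts (ugraph S2) \<Longrightarrow> \<theta> v \<in> {1, -1 :: real}"
      "\<And>u v. (u, v) \<in> parcs (ugraph S2) \<Longrightarrow> esign S2 (u, v) = \<theta> u * \<theta> v"
      using S2.balanced_potential[OF \<open>balanced S2\<close> assms(4)] by metis
    \<comment> \<open>Arcs of the product project to arcs of the first factor, and the remaining
      sign factor comes from the potential on the second.\<close>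
    show ?thesis
      by (rule bdim_le_of_hom[where f = fst and \<theta> = "\<lambda>x. \<theta> (snd x)", OF assms(1)])
        (auto simp: tensor_product_def \<theta>(2) dest: arc_ends \<theta>(1))
  qed
  show "bdim (tensor_product S1 S2) \<le> bdim S2" if "balanced S1"
  proof -
    obtain \<theta> where \<theta>: "\<And>v. v \<in> pverts (ugraph S1) \<Longrightarrow> \<theta> v \<in> {1, -1 :: real}"
      "\<And>u v. (u, v) \<in> parcs (ugraph S1) \<Longrightarrow> esign S1 (u, v) = \<theta> u * \<theta> v"
      using S1.balanced_potential[OF \<open>balanced S1\<close> assms(2)] by metis
    show ?thesis
      by (rule bdim_le_of_hom[where f = snd and \<theta> = "\<lambda>x. \<theta> (fst x)", OF assms(3)])
        (auto simp: tensor_product_def \<theta>(2) dest: arc_ends \<theta>(1))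
  qed
qed

end
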